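(* Let $(\Omega,\mathcal{A},\mathbb{P})$ be a probability space and let $(E_n)_{n\in\mathbb{N}}$ be an independent family of events. Let $\mathcal{O}:=\sum_{n=1}^\infty\mathbf{1}_{E_n}$. Then the following hold. 1. If $\sum_{n=1}^\infty\mathbb{P}(E_n)=\infty$, then $\mathcal{O}=\infty$ almost surely. 2. If $\sum_{n=1}^\infty\mathbb{P}(E_n)<\infty$, then $\mathcal{O}<\infty$ almost surely, and $$\mathbb{E}\big[e^{r\mathcal{O}}\big]\leqslant \inf_{\delta>1}\frac{\delta}{\delta-1}\exp\big(r\cdot L^{-1}(e^{-r}/\delta)\big)<\infty$$ for all $r>0$ and any nonincreasing, invertible function $L:(0,\infty)\to(0,\infty)$ such that $L(m)=\sum_{n=m}^\infty\mathbb{P}(E_n)$ for all $m\in\mathbb{N}$.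
   Context: $\mathbb{N}=\{1,2,\dots\}$. $L^{-1}:(0,\infty)\to(0,\infty)$ is the inverse function of $L$. *)

theory Defs
  imports "HOL-Probability.Probability"
begin

text \<open>The sequence of events is indexed by \<open>1, 2, \<dots>\<close>; the value \<open>E 0\<close> is ignored.\<close>

definition occurrences :: "(nat \<Rightarrow> 'a set) \<Rightarrow> 'a \<Rightarrow> ennreal" where
  "occurrences E \<omega> = (\<Sum>n. indicator (E (Suc n)) \<omega>)"

text \<open>The exponential function on \<open>[0,\<infinity>]\<close>, with \<open>exp \<infinity> = \<infinity>\<close>.\<close>

definition ennexp :: "ennreal \<Rightarrow> ennreal" where
  "ennexp x = (if x = \<infinity> then \<infinity> else ennreal (exp (enn2real x)))"

end

theory Submission
  imports Defs
begin

text \<open>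
  Both halves rest on one exponential moment bound. For finitely many independent events with
  probabilities \<open>p\<^sub>i\<close> and for any real \<open>s\<close> of either sign, the number \<open>N\<close> of
  events that occur satisfies
  \<open>\<bbbE>[exp (s N)] = \<Prod>(1 + (exp s - 1) p\<^sub>i) \<le> exp ((exp s - 1) \<Sum>p\<^sub>i)\<close>
  (lemma \<open>nn_integral_exp_sum_indicator_le\<close>).

  With \<open>s = -1\<close> the factor \<open>exp s - 1\<close> is negative, so a divergent sum of probabilities forces
  \<open>\<bbbE>[exp (-\<O>)] = 0\<close>, that is, \<open>\<O> = \<infinity>\<close> almost surely. If the sum converges, it equals
  \<open>\<bbbE>[\<O>]\<close>, hence \<open>\<O>\<close> is almost surely finite.

  With \<open>s = r > 0\<close>, the first \<open>k\<close> events contribute at most \<open>k\<close> to \<open>\<O>\<close>, and the moment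
  bound controls the others, which gives
  \<open>\<bbbE>[exp (r \<O>)] \<le> exp (r k + (exp r - 1) a)\<close> whenever \<open>a\<close> bounds the tail sum after the
  first \<open>k\<close> events (lemma \<open>nn_integral_ennexp_suminf_indicator_le\<close>). The threshold
  \<open>x = L\<^sup>-\<^sup>1 (exp (-r) / \<delta>)\<close> is the place where \<open>L\<close>, which interpolates
  the tail sums, equals \<open>exp (-r) / \<delta>\<close>.
  Taking for \<open>k\<close> the largest integer strictly below \<open>x\<close> makes the exponent at most \<open>r x + 1 / \<delta>\<close>,
  and \<open>exp (1 / \<delta>) \<le> \<delta> / (\<delta> - 1)\<close> because \<open>1 - u \<le> exp (-u)\<close>.
\<close>

context prob_space
begin

text \<open>
  Expanding the product over the subsets of \<open>A\<close> turns every summand into a multiple of the indicator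
  of an intersection. Independence factors its probability, and the same expansion read
  backwards reassembles the product.
\<close>

lemma expectation_prod_one_plus_indicator:
  assumes "indep_events F I" "finite A" "A \<subseteq> I"
  shows "expectation (\<lambda>\<omega>. \<Prod>i\<in>A. 1 + t * indicat_real (F i) \<omega>) = (\<Prod>i\<in>A. 1 + t * prob (F i))"
proof -
  have ev: "F i \<in> events" if "i \<in> A" for i
    using assms that by (auto simp: indep_events_def)
  have expand: "(\<Prod>i\<in>A. 1 + t * f i) = (\<Sum>B\<in>Pow A. t ^ card B * (\<Prod>i\<in>B. f i))" for f :: "'b \<Rightarrow> real"
    using prod_add[OF assms(2), of "\<lambda>i. t * f i" "\<lambda>_. 1"]
    by (simp add: prod.distrib add.commute)
  have int: "integrable M (\<lambda>\<omega>. \<Prod>i\<in>B. indicat_real (F i) \<omega>)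
      \<and> expectation (\<lambda>\<omega>. \<Prod>i\<in>B. indicat_real (F i) \<omega>) = (\<Prod>i\<in>B. prob (F i))" if B: "B \<subseteq> A" for B
  proof (cases "B = {}")
    case True
    then show ?thesis by (simp add: prob_space)
  next
    case False
    have fin: "finite B" using B assms(2) by (rule finite_subset)
    have eq: "(\<lambda>\<omega>. \<Prod>i\<in>B. indicat_real (F i) \<omega>) = indicator (\<Inter>i\<in>B. F i)"
      using fin by (auto simp: fun_eq_iff indicator_def)
    have "(\<Inter>i\<in>B. F i) \<in> events"
      using fin False B ev by (intro sets.finite_INT) auto
    moreover have "prob (\<Inter>i\<in>B. F i) = (\<Prod>i\<in>B. prob (F i))"
      using assms B False fin by (auto simp: indep_events_def)
    ultimately show ?thesis unfolding eq by (simp add: emeasure_eq_measure)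
  qed
  show ?thesis
    unfolding expand using int by (subst Bochner_Integration.integral_sum) auto
qed

text \<open>
  An indicator takes only the values 0 and 1, so \<open>exp (s 1\<^sub>E) = 1 + (exp s - 1) 1\<^sub>E\<close>, and the
  exponential of the sum is a product of the kind evaluated above. Each factor
  \<open>1 + (exp s - 1) p\<close> is then at most \<open>exp ((exp s - 1) p)\<close>.
\<close>

lemma nn_integral_exp_sum_indicator_le:
  assumes "indep_events F I" "finite A" "A \<subseteq> I"
  shows "(\<integral>\<^sup>+\<omega>. ennreal (exp (s * (\<Sum>i\<in>A. indicat_real (F i) \<omega>))) \<partial>M)
    \<le> ennreal (exp ((exp s - 1) * (\<Sum>i\<in>A. prob (F i))))"
proof -
  have [measurable]: "F i \<in> events" if "i \<in> A" for i
    using assms that by (auto simp: indep_events_def)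
  let ?f = "\<lambda>\<omega>. \<Prod>i\<in>A. 1 + (exp s - 1) * indicat_real (F i) \<omega>"
  have eq: "exp (s * (\<Sum>i\<in>A. indicat_real (F i) \<omega>)) = ?f \<omega>" for \<omega>
    unfolding sum_distrib_left exp_sum[OF assms(2)]
    by (intro prod.cong) (auto simp: indicator_def)
  have nn: "0 \<le> ?f \<omega>" for \<omega>
    by (subst eq[symmetric]) simp
  have "integrable M ?f"
  proof (rule integrable_const_bound)
    show "AE \<omega> in M. norm (?f \<omega>) \<le> (\<Prod>i\<in>A. max 1 (exp s))"
      unfolding prod_norm[symmetric]
      by (intro AE_I2 prod_mono) (auto simp: indicator_def)
  qed measurable
  then have "(\<integral>\<^sup>+\<omega>. ennreal (?f \<omega>) \<partial>M) = ennreal (\<Prod>i\<in>A. 1 + (exp s - 1) * prob (F i))"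
    using nn expectation_prod_one_plus_indicator[OF assms, of "exp s - 1"]
    by (subst nn_integral_eq_integral) auto
  also have "(\<Prod>i\<in>A. 1 + (exp s - 1) * prob (F i)) \<le> (\<Prod>i\<in>A. exp ((exp s - 1) * prob (F i)))"
    \<comment> \<open>Negative \<open>s\<close> is allowed, so that the factors are nonnegative needs an argument:
      each is the convex combination \<open>(1 - p) + p exp s\<close>.\<close>
  proof (intro prod_mono conjI exp_ge_add_one_self)
    fix i
    have "0 \<le> (1 - prob (F i)) + exp s * prob (F i)" by simp
    then show "0 \<le> 1 + (exp s - 1) * prob (F i)" by (simp add: algebra_simps)
  qed
  also have "\<dots> = exp ((exp s - 1) * (\<Sum>i\<in>A. prob (F i)))"
    by (simp add: exp_sum[OF assms(2)] sum_distrib_left)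
  finally show ?thesis unfolding eq by (simp add: ennreal_leI)
qed

text \<open>
  The second Borel--Cantelli lemma in counting form. The function \<open>g\<close> is \<open>exp (-N)\<close> with
  \<open>exp (-\<infinity>) = 0\<close>. It lies below \<open>exp (-N\<^sub>k)\<close> for every partial count \<open>N\<^sub>k\<close>, whose integral
  tends to 0 by the moment bound, so \<open>g\<close> vanishes almost everywhere.
\<close>

lemma AE_suminf_indicator_eq_top:
  fixes F :: "nat \<Rightarrow> 'a set"
  assumes indep: "indep_events F UNIV" and div: "(\<Sum>n. emeasure M (F n)) = \<top>"
  shows "AE \<omega> in M. (\<Sum>n. indicator (F n) \<omega>) = (\<top>::ennreal)"
proof -
  have [measurable]: "F n \<in> events" for n
    using indep by (auto simp: indep_events_def)
  define N :: "'a \<Rightarrow> ennreal" where "N \<omega> = (\<Sum>n. indicator (F n) \<omega>)" for \<omega>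
  define g where "g \<omega> = (if N \<omega> = \<top> then 0 else ennreal (exp (- enn2real (N \<omega>))))" for \<omega>
  have [measurable]: "N \<in> borel_measurable M" unfolding N_def by measurable
  have [measurable]: "g \<in> borel_measurable M" unfolding g_def by measurable
  have g_le: "g \<omega> \<le> ennreal (exp (- 1 * (\<Sum>i<k. indicat_real (F i) \<omega>)))" for \<omega> k
  proof (cases "N \<omega> = \<top>")
    case False
    have "ennreal (\<Sum>i<k. indicat_real (F i) \<omega>) = (\<Sum>i<k. indicator (F i) \<omega>)"
      by (simp add: sum_ennreal[symmetric] ennreal_indicator)
    also have "\<dots> \<le> N \<omega>"
      unfolding N_def by (rule sum_le_suminf) auto
    finally have "(\<Sum>i<k. indicat_real (F i) \<omega>) \<le> enn2real (N \<omega>)"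
      using enn2real_mono[of "ennreal (\<Sum>i<k. indicat_real (F i) \<omega>)" "N \<omega>"] False
      by (simp add: less_top[symmetric] sum_nonneg)
    then show ?thesis using False by (simp add: g_def ennreal_leI)
  qed (simp add: g_def)
  have "(\<integral>\<^sup>+\<omega>. g \<omega> \<partial>M) \<le> ennreal \<epsilon>" if "0 < \<epsilon>" for \<epsilon>
  proof -
    define c :: real where "c = 1 - exp (- 1)"
    have c: "0 < c" unfolding c_def by simp
    \<comment> \<open>The partial sum of probabilities is taken so large that \<open>exp (- c \<Sum>p\<^sub>i) \<le> \<epsilon>\<close>.\<close>
    have "ennreal (- ln \<epsilon> / c) < (SUP k. \<Sum>i<k. emeasure M (F i))"
      using div by (simp add: suminf_eq_SUP[symmetric])
    then obtain k where "ennreal (- ln \<epsilon> / c) < (\<Sum>i<k. emeasure M (F i))"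
      by (auto simp: less_SUP_iff)
    also have "\<dots> = ennreal (\<Sum>i<k. prob (F i))"
      by (simp add: emeasure_eq_measure sum_ennreal)
    finally have "- ln \<epsilon> / c < (\<Sum>i<k. prob (F i))"
      by (meson ennreal_leI not_le)
    then have le: "- ln \<epsilon> \<le> c * (\<Sum>i<k. prob (F i))"
      using c by (simp add: field_simps)
    have "(\<integral>\<^sup>+\<omega>. g \<omega> \<partial>M)
        \<le> (\<integral>\<^sup>+\<omega>. ennreal (exp (- 1 * (\<Sum>i<k. indicat_real (F i) \<omega>))) \<partial>M)"
      by (intro nn_integral_mono g_le)
    also have "\<dots> \<le> ennreal (exp ((exp (- 1) - 1) * (\<Sum>i<k. prob (F i))))"
      using indep by (intro nn_integral_exp_sum_indicator_le) auto
    also have "\<dots> \<le> ennreal (exp (ln \<epsilon>))"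
      using le by (intro ennreal_leI) (simp add: c_def algebra_simps)
    finally show ?thesis using that by simp
  qed
  then have "(\<integral>\<^sup>+\<omega>. g \<omega> \<partial>M) \<le> 0"
    by - (rule ennreal_le_epsilon, simp)
  then have "AE \<omega> in M. g \<omega> = 0"
    by (simp add: nn_integral_0_iff_AE)
  then show ?thesis
    by eventually_elim (auto simp: g_def N_def split: if_splits)
qed

lemma AE_suminf_indicator_less_top:
  fixes F :: "nat \<Rightarrow> 'a set"
  assumes [measurable]: "\<And>n. F n \<in> events" and fin: "(\<Sum>n. emeasure M (F n)) < \<top>"
  shows "AE \<omega> in M. (\<Sum>n. indicator (F n) \<omega>) < (\<top>::ennreal)"
proof -
  have "(\<integral>\<^sup>+\<omega>. (\<Sum>n. indicator (F n) \<omega>) \<partial>M) = (\<Sum>n. emeasure M (F n))"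
    by (subst nn_integral_suminf) auto
  then have "AE \<omega> in M. (\<Sum>n. indicator (F n) \<omega>) \<noteq> (\<infinity>::ennreal)"
    using fin by (intro nn_integral_PInf_AE) auto
  then show ?thesis by (simp add: less_top)
qed

text \<open>
  The bound holds for every partial count \<open>S N\<close>, uniformly in \<open>N\<close>, and passes to the limit by
  monotone convergence. Almost sure finiteness of the count makes \<open>exp (r S N)\<close> converge to
  the integrand.
\<close>

lemma nn_integral_ennexp_suminf_indicator_le:
  fixes F :: "nat \<Rightarrow> 'a set"
  assumes indep: "indep_events F UNIV" and r: "0 < r" and a: "0 \<le> a"
    and tail: "(\<Sum>n. emeasure M (F (k + n))) \<le> ennreal a"
  shows "(\<integral>\<^sup>+\<omega>. ennexp (ennreal r * (\<Sum>n. indicator (F n) \<omega>)) \<partial>M)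
    \<le> ennreal (exp (r * real k + (exp r - 1) * a))"
proof -
  have [measurable]: "F n \<in> events" for n
    using indep by (auto simp: indep_events_def)
  define S where "S N \<omega> = (\<Sum>i<N. indicat_real (F i) \<omega>)" for N \<omega>
  have [measurable]: "S N \<in> borel_measurable M" for N
    unfolding S_def by measurable
  have inc: "incseq (\<lambda>N \<omega>. ennreal (exp (r * S N \<omega>)))"
    unfolding S_def using r
    by (intro monoI le_funI ennreal_leI) (auto intro!: sum_mono2)
  have bound: "(\<integral>\<^sup>+\<omega>. ennreal (exp (r * S N \<omega>)) \<partial>M)
      \<le> ennreal (exp (r * real k + (exp r - 1) * a))" for N
  proof -
    have "ennreal (\<Sum>i\<in>{k..<k + N}. prob (F i)) = (\<Sum>n<N. emeasure M (F (k + n)))"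
      unfolding emeasure_eq_measure
      using sum.shift_bounds_nat_ivl[of "\<lambda>i. prob (F i)" 0 k N]
      by (simp add: sum_ennreal add.commute atLeast0LessThan)
    also have "\<dots> \<le> ennreal a"
      by (rule order_trans[OF sum_le_suminf tail]) auto
    finally have p: "(\<Sum>i\<in>{k..<k + N}. prob (F i)) \<le> a"
      using a by simp
    have split: "S N \<omega> \<le> real k + (\<Sum>i\<in>{k..<k + N}. indicat_real (F i) \<omega>)" for \<omega>
    proof -
      have "S N \<omega> \<le> (\<Sum>i\<in>{..<k} \<union> {k..<k + N}. indicat_real (F i) \<omega>)"
        unfolding S_def by (intro sum_mono2) auto
      also have "\<dots> = (\<Sum>i<k. indicat_real (F i) \<omega>) + (\<Sum>i\<in>{k..<k + N}. indicat_real (F i) \<omega>)"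
        by (intro sum.union_disjoint) auto
      also have "(\<Sum>i<k. indicat_real (F i) \<omega>) \<le> real (card {..<k}) * 1"
        by (intro sum_bounded_above) (simp add: indicator_def)
      finally show ?thesis by simp
    qed
    have "(\<integral>\<^sup>+\<omega>. ennreal (exp (r * S N \<omega>)) \<partial>M)
        \<le> (\<integral>\<^sup>+\<omega>. ennreal (exp (r * real k)) *
              ennreal (exp (r * (\<Sum>i\<in>{k..<k + N}. indicat_real (F i) \<omega>))) \<partial>M)"
      using split r
      by (intro nn_integral_mono)
         (auto simp: ennreal_mult[symmetric] exp_add[symmetric] distrib_left[symmetric] intro!: ennreal_leI)
    also have "\<dots> = ennreal (exp (r * real k)) *
        (\<integral>\<^sup>+\<omega>. ennreal (exp (r * (\<Sum>i\<in>{k..<k + N}. indicat_real (F i) \<omega>))) \<partial>M)"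
      by (rule nn_integral_cmult) measurable
    also have "\<dots> \<le> ennreal (exp (r * real k)) *
        ennreal (exp ((exp r - 1) * (\<Sum>i\<in>{k..<k + N}. prob (F i))))"
      using indep by (intro mult_left_mono nn_integral_exp_sum_indicator_le) auto
    also have "\<dots> \<le> ennreal (exp (r * real k + (exp r - 1) * a))"
      using p r by (simp add: ennreal_mult[symmetric] exp_add[symmetric] mult_left_mono ennreal_leI)
    finally show ?thesis .
  qed
  have "(\<Sum>n. emeasure M (F n)) < \<top>"
  proof -
    have "(\<Sum>n. emeasure M (F n)) = (\<Sum>n. emeasure M (F (n + k))) + (\<Sum>n<k. emeasure M (F n))"
      by (intro suminf_offset) auto
    also have "\<dots> < \<top>"
      using tail le_less_trans[OF tail ennreal_less_top]
      by (auto simp: add.commute emeasure_eq_measure sum_ennreal less_top)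
    finally show ?thesis .
  qed
  then have "AE \<omega> in M. (\<Sum>n. indicator (F n) \<omega>) < (\<top>::ennreal)"
    by (intro AE_suminf_indicator_less_top) auto
  then have "AE \<omega> in M. ennexp (ennreal r * (\<Sum>n. indicator (F n) \<omega>)) \<le> (SUP N. ennreal (exp (r * S N \<omega>)))"
  proof eventually_elim
    case (elim \<omega>)
    then have "(\<Sum>n. ennreal (indicat_real (F n) \<omega>)) \<noteq> \<top>"
      by (simp add: ennreal_indicator less_top)
    then have sm: "summable (\<lambda>n. indicat_real (F n) \<omega>)"
      by (intro summable_suminf_not_top) auto
    define X where "X = (\<Sum>n. indicat_real (F n) \<omega>)"
    have X0: "0 \<le> X" unfolding X_def using sm by (intro suminf_nonneg) auto
    have "(\<Sum>n. indicator (F n) \<omega>) = ennreal X"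
      unfolding X_def using suminf_ennreal2[OF _ sm] by (simp add: ennreal_indicator)
    then have eq: "ennexp (ennreal r * (\<Sum>n. indicator (F n) \<omega>)) = ennreal (exp (r * X))"
      using r X0 by (simp add: ennexp_def ennreal_mult[symmetric])
    have "(\<lambda>N. S N \<omega>) \<longlonglongrightarrow> X"
      unfolding S_def X_def using sm by (rule summable_LIMSEQ)
    then have "(\<lambda>N. ennreal (exp (r * S N \<omega>))) \<longlonglongrightarrow> ennreal (exp (r * X))"
      by (intro tendsto_intros)
    then show ?case unfolding eq
      by (rule LIMSEQ_le_const2) (intro exI allI impI SUP_upper UNIV_I)
  qed
  then have "(\<integral>\<^sup>+\<omega>. ennexp (ennreal r * (\<Sum>n. indicator (F n) \<omega>)) \<partial>M)
      \<le> (\<integral>\<^sup>+\<omega>. (SUP N. ennreal (exp (r * S N \<omega>))) \<partial>M)"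
    by (rule nn_integral_mono_AE)
  also have "\<dots> = (SUP N. \<integral>\<^sup>+\<omega>. ennreal (exp (r * S N \<omega>)) \<partial>M)"
    by (intro nn_integral_monotone_convergence_SUP inc) measurable
  also have "\<dots> \<le> ennreal (exp (r * real k + (exp r - 1) * a))"
    by (intro SUP_least bound)
  finally show ?thesis .
qed

text \<open>
  The previous bound is applied with \<open>k \<le> x \<le> k + 1\<close>, where \<open>L x = exp (-r) / \<delta>\<close>. Since \<open>F\<close>
  starts at index 0, the tail sum beginning with \<open>F k\<close> is \<open>L (k + 1)\<close>, which is at most \<open>L x\<close>
  by monotonicity, while \<open>k \<le> x\<close> lets \<open>x\<close> replace \<open>k\<close> in the exponent.
\<close>

lemma nn_integral_ennexp_suminf_indicator_le_inverse_tail: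
  fixes F :: "nat \<Rightarrow> 'a set" and L :: "real \<Rightarrow> real"
  assumes indep: "indep_events F UNIV" and r: "0 < r" and \<delta>: "1 < \<delta>"
    and L: "bij_betw L {0<..} {0<..}" "antimono_on {0<..} L"
    and tail: "\<And>k. ennreal (L (real (Suc k))) = (\<Sum>n. emeasure M (F (k + n)))"
  shows "(\<integral>\<^sup>+\<omega>. ennexp (ennreal r * (\<Sum>n. indicator (F n) \<omega>)) \<partial>M)
    \<le> ennreal (\<delta> / (\<delta> - 1) * exp (r * inv_into {0<..} L (exp (- r) / \<delta>)))"
proof -
  define x where "x = inv_into {0<..} L (exp (- r) / \<delta>)"
  have img: "exp (- r) / \<delta> \<in> L ` {0<..}"
    using L(1) \<delta> by (simp add: bij_betw_def)
  have x: "0 < x" "L x = exp (- r) / \<delta>"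
    using inv_into_into[OF img] f_inv_into_f[OF img] by (auto simp: x_def)
  define k where "k = nat \<lceil>x\<rceil> - 1"
  have k: "real k \<le> x" "x \<le> real (Suc k)"
    using x(1) unfolding k_def by linarith+
  have "L (real (Suc k)) \<le> L x"
    using L(2) x(1) k(2) by (auto simp: monotone_on_def)
  then have "(\<Sum>n. emeasure M (F (k + n))) \<le> ennreal (exp (- r) / \<delta>)"
    unfolding tail[symmetric] x(2) by (rule ennreal_leI)
  then have "(\<integral>\<^sup>+\<omega>. ennexp (ennreal r * (\<Sum>n. indicator (F n) \<omega>)) \<partial>M)
      \<le> ennreal (exp (r * real k + (exp r - 1) * (exp (- r) / \<delta>)))"
    using indep r \<delta> by (intro nn_integral_ennexp_suminf_indicator_le) auto
  also have "\<dots> \<le> ennreal (\<delta> / (\<delta> - 1) * exp (r * x))"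
  proof (rule ennreal_leI)
    have "(exp r - 1) * (exp (- r) / \<delta>) = (1 - exp (- r)) / \<delta>"
      by (simp add: field_simps exp_minus)
    also have "\<dots> \<le> 1 / \<delta>"
      using \<delta> by (intro divide_right_mono) auto
    finally have "exp (r * real k + (exp r - 1) * (exp (- r) / \<delta>)) \<le> exp (1 / \<delta>) * exp (r * x)"
      unfolding exp_add[symmetric] exp_le_cancel_iff
      using mult_left_mono[OF k(1), of r] r by linarith
    also have "exp (1 / \<delta>) \<le> \<delta> / (\<delta> - 1)"
    proof -
      have "(\<delta> - 1) / \<delta> \<le> exp (- (1 / \<delta>))"
        using exp_ge_add_one_self[of "- (1 / \<delta>)"] \<delta> by (simp add: field_simps)
      then have "inverse (exp (- (1 / \<delta>))) \<le> inverse ((\<delta> - 1) / \<delta>)"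
        using \<delta> by (intro le_imp_inverse_le) auto
      then show ?thesis by (simp add: exp_minus)
    qed
    finally show "exp (r * real k + (exp r - 1) * (exp (- r) / \<delta>)) \<le> \<delta> / (\<delta> - 1) * exp (r * x)"
      by simp
  qed
  finally show ?thesis unfolding x_def .
qed

end

theorem corollary4:
  fixes M :: "'a measure" and E :: "nat \<Rightarrow> 'a set"
  assumes "prob_space M"
    and "prob_space.indep_events M E {1..}"
  shows "((\<Sum>n. emeasure M (E (Suc n))) = \<infinity> \<longrightarrow> (AE \<omega> in M. occurrences E \<omega> = \<infinity>)) \<and>
    ((\<Sum>n. emeasure M (E (Suc n))) < \<infinity> \<longrightarrow>
      (AE \<omega> in M. occurrences E \<omega> < \<infinity>) \<and>
      (\<forall>(r::real) (L :: real \<Rightarrow> real).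
        0 < r \<and> bij_betw L {0<..} {0<..} \<and> antimono_on {0<..} L \<and>
        (\<forall>m::nat. 1 \<le> m \<longrightarrow> ennreal (L (real m)) = (\<Sum>n. emeasure M (E (m + n)))) \<longrightarrow>
        (\<integral>\<^sup>+ \<omega>. ennexp (ennreal r * occurrences E \<omega>) \<partial>M)
          \<le> (INF \<delta>\<in>{1<..}. ennreal (\<delta> / (\<delta> - 1) * exp (r * inv_into {0<..} L (exp (- r) / \<delta>)))) \<and>
        (INF \<delta>\<in>{1<..}. ennreal (\<delta> / (\<delta> - 1) * exp (r * inv_into {0<..} L (exp (- r) / \<delta>)))) < \<infinity>))"
proof -
  interpret prob_space M by fact
  define F where "F = (\<lambda>n. E (Suc n))"
  have ev: "E n \<in> events" if "1 \<le> n" for n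
    using assms(2) that by (auto simp: indep_events_def)
  have indep: "indep_events F UNIV"
  proof (rule indep_eventsI)
    fix J :: "nat set" assume J: "finite J" "J \<noteq> {}"
    have "Suc ` J \<subseteq> {1..}" by auto
    then have "prob (\<Inter>i\<in>Suc ` J. E i) = (\<Prod>i\<in>Suc ` J. prob (E i))"
      using assms(2) J unfolding indep_events_def by blast
    then show "prob (\<Inter>i\<in>J. F i) = (\<Prod>i\<in>J. prob (F i))"
      by (simp add: F_def prod.reindex)
  qed (simp add: F_def ev)
  have occ: "occurrences E = (\<lambda>\<omega>. \<Sum>n. indicator (F n) \<omega>)"
    by (simp add: fun_eq_iff occurrences_def F_def)
  have INF_finite: "(INF \<delta>\<in>{1<..}. ennreal (f \<delta>)) < \<infinity>" for f :: "real \<Rightarrow> real"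
    by (rule le_less_trans[OF INF_lower[of 2]]) auto
  have bound: "(\<integral>\<^sup>+ \<omega>. ennexp (ennreal r * occurrences E \<omega>) \<partial>M)
      \<le> (INF \<delta>\<in>{1<..}. ennreal (\<delta> / (\<delta> - 1) * exp (r * inv_into {0<..} L (exp (- r) / \<delta>))))"
    if "0 < r" "bij_betw L {0<..} {0<..}" "antimono_on {0<..} L"
      and "\<forall>m::nat. 1 \<le> m \<longrightarrow> ennreal (L (real m)) = (\<Sum>n. emeasure M (E (m + n)))"
    for r :: real and L :: "real \<Rightarrow> real"
    unfolding occ using that indep
    by (intro INF_greatest nn_integral_ennexp_suminf_indicator_le_inverse_tail) (auto simp: F_def)
  have infinite: "AE \<omega> in M. occurrences E \<omega> = \<infinity>" if "(\<Sum>n. emeasure M (E (Suc n))) = \<infinity>"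
    using AE_suminf_indicator_eq_top[OF indep] that by (simp add: occ F_def)
  have finite: "AE \<omega> in M. occurrences E \<omega> < \<infinity>" if "(\<Sum>n. emeasure M (E (Suc n))) < \<infinity>"
    using AE_suminf_indicator_less_top[of F] that ev by (simp add: occ F_def)
  show ?thesis
    by (intro conjI impI allI; (elim conjE)?;
        (rule infinite finite INF_finite bound; assumption))
qed

end
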